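(* Let $\mathbb{F}$ be an algebraically closed field (of arbitrary characteristic). Every nontrivial $2$-dimensional evolution algebra over $\mathbb{F}$ is isomorphic to exactly one of the algebras given by the following matrices of structure constants (where in the first family $E_1(b,c)$ and $E_1(c,b)$ are isomorphic and are regarded as the same entry of the list): \begin{itemize} \item $E_{1}(b,c)=\begin{pmatrix} 1 & 0 & 0 & b\\ c & 0 & 0 & 1\end{pmatrix}$ with $(b,c)\in\mathbb{F}^2$, $bc\neq 1$, where $E_1(b,c)\simeq E_1(c,b)$; \item $E_{2}(b)=\begin{pmatrix} 1 & 0 & 0 & b\\ 1 & 0 & 0 & 0\end{pmatrix}$ with $b\in\mathbb{F}$; \item $E_{3}=\begin{pmatrix} 0 & 0 & 0 & 1\\ 1 & 0 & 0 & 0\end{pmatrix}$; \item $E_{4}=\begin{pmatrix} 1 & 0 & 0 & 1\\ 0 & 0 & 0 & 0\end{pmatrix}$; \item $E_5=\begin{pmatrix} 1 & 0 & 0 & -1\\ -1 & 0 & 0 & 1\end{pmatrix}$; \item $E_{6}=\begin{pmatrix} 0 & 0 & 0 & 1\\ 0 & 0 & 0 & 0\end{pmatrix}$. \end{itemize} That is, every nontrivial $2$-dimensional evolution algebra over $\mathbb{F}$ is isomorphic to some algebra in the list, and two algebras of the list given by different entries (different family indices, or the same family with different parameters) are isomorphic only in the case of $E_1(b,c)$ and $E_1(c,b)$.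
   Context: An algebra over $\mathbb{F}$ is a vector space with a bilinear multiplication (not assumed associative, commutative or unital). It is nontrivial if its multiplication is not identically zero. An $n$-dimensional algebra is an evolution algebra if it admits a basis $\{e_1,\dots,e_n\}$ with $e_i\cdot e_j=0$ whenever $i\neq j$. Matrix of structure constants (MSC): for a $2$-dimensional algebra $\mathbb{A}$ with basis $(e_1,e_2)$ and $e_i\cdot e_j=A^1_{i,j}e_1+A^2_{i,j}e_2$, its MSC is $$A=\begin{pmatrix} A^1_{1,1}&A^1_{1,2}&A^1_{2,1}&A^1_{2,2}\\ A^2_{1,1}&A^2_{1,2}&A^2_{2,1}&A^2_{2,2}\end{pmatrix}\in Mat(2\times 4;\mathbb{F}),$$ so that in coordinate column vectors the product of $u$ and $v$ is $A(u\otimes v)$ (Kronecker product). An algebra is identified with its MSC. Two $2$-dimensional algebras with MSCs $A,B$ are isomorphic if $B=gA(g^{-1}\otimes g^{-1})$ for some $g\in GL(2,\mathbb{F})$ (this is the usual notion of isomorphism of algebras); $\simeq$ denotes isomorphism. *)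

theory Defs
  imports "HOL-Analysis.Analysis" "HOL-Computational_Algebra.Polynomial"
begin
definition is_algebra :: "('f::field \<Rightarrow> 'v::ab_group_add \<Rightarrow> 'v) \<Rightarrow> ('v \<Rightarrow> 'v \<Rightarrow> 'v) \<Rightarrow> bool" where
  "is_algebra smul mul \<longleftrightarrow>
     vector_space smul \<and>
     (\<forall>x. Vector_Spaces.linear smul smul (\<lambda>y. mul x y)) \<and>
     (\<forall>y. Vector_Spaces.linear smul smul (\<lambda>x. mul x y))"

definition nontrivial_mult :: "('v::ab_group_add \<Rightarrow> 'v \<Rightarrow> 'v) \<Rightarrow> bool" where
  "nontrivial_mult mul \<longleftrightarrow> (\<exists>x y. mul x y \<noteq> 0)"

definition is_basis :: "('f::field \<Rightarrow> 'v::ab_group_add \<Rightarrow> 'v) \<Rightarrow> 'v set \<Rightarrow> bool" where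
  "is_basis smul B \<longleftrightarrow> \<not> module.dependent smul B \<and> module.span smul B = UNIV"

definition is_evolution_algebra ::
    "nat \<Rightarrow> ('f::field \<Rightarrow> 'v::ab_group_add \<Rightarrow> 'v) \<Rightarrow> ('v \<Rightarrow> 'v \<Rightarrow> 'v) \<Rightarrow> bool" where
  "is_evolution_algebra n smul mul \<longleftrightarrow>
     is_algebra smul mul \<and>
     (\<exists>B. is_basis smul B \<and> finite B \<and> card B = n \<and>
          (\<forall>x\<in>B. \<forall>y\<in>B. x \<noteq> y \<longrightarrow> mul x y = 0))"

text \<open>
  The columns of a matrix of structure constants are ordered as
  \<open>(1,1), (1,2), (2,1), (2,2)\<close>: the column \<open>j :: 4\<close> belongs to the pair
  \<open>(pair_fst j, pair_snd j)\<close>. The type \<open>'f^4^2\<close> is the type of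
  matrices with 2 rows and 4 columns.
\<close>

definition pair_fst :: "4 \<Rightarrow> 2" where
  "pair_fst j = (if j = 1 \<or> j = 2 then 1 else 2)"

definition pair_snd :: "4 \<Rightarrow> 2" where
  "pair_snd j = (if j = 1 \<or> j = 3 then 1 else 2)"

definition kron_vec :: "'f::semiring_1^2 \<Rightarrow> 'f^2 \<Rightarrow> 'f^4" where
  "kron_vec u v = (\<chi> j. u $ pair_fst j * v $ pair_snd j)"

definition kron_mat :: "'f::semiring_1^2^2 \<Rightarrow> 'f^2^2 \<Rightarrow> 'f^4^4" where
  "kron_mat g h = (\<chi> i j. g $ pair_fst i $ pair_fst j * h $ pair_snd i $ pair_snd j)"

definition is_ordered_basis2 :: "('f::field \<Rightarrow> 'v::ab_group_add \<Rightarrow> 'v) \<Rightarrow> (2 \<Rightarrow> 'v) \<Rightarrow> bool" where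
  "is_ordered_basis2 smul e \<longleftrightarrow> inj e \<and> is_basis smul (range e)"

definition msc ::
    "('f::field \<Rightarrow> 'v::ab_group_add \<Rightarrow> 'v) \<Rightarrow> ('v \<Rightarrow> 'v \<Rightarrow> 'v) \<Rightarrow> (2 \<Rightarrow> 'v) \<Rightarrow> 'f^4^2" where
  "msc smul mul e =
     (\<chi> k j. module.representation smul (range e) (mul (e (pair_fst j)) (e (pair_snd j))) (e k))"

definition msc_iso :: "'f::field^4^2 \<Rightarrow> 'f^4^2 \<Rightarrow> bool" (infix "\<simeq>\<^sub>A" 50) where
  "A \<simeq>\<^sub>A B \<longleftrightarrow>
     (\<exists>g :: 'f^2^2. invertible g \<and> B = g ** A ** kron_mat (matrix_inv g) (matrix_inv g))"

definition mat24 :: "'f::zero \<Rightarrow> 'f \<Rightarrow> 'f \<Rightarrow> 'f \<Rightarrow> 'f \<Rightarrow> 'f \<Rightarrow> 'f \<Rightarrow> 'f \<Rightarrow> 'f^4^2" where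
  "mat24 a1 a2 a3 a4 b1 b2 b3 b4 = vector [vector [a1, a2, a3, a4], vector [b1, b2, b3, b4]]"

datatype 'f entry = E1 'f 'f | E2 'f | E3 | E4 | E5 | E6

fun in_list :: "'f::field entry \<Rightarrow> bool" where
  "in_list (E1 b c) \<longleftrightarrow> b * c \<noteq> 1"
| "in_list _ \<longleftrightarrow> True"

fun entry_msc :: "'f::field entry \<Rightarrow> 'f^4^2" where
  "entry_msc (E1 b c) = mat24 1 0 0 b
                              c 0 0 1"
| "entry_msc (E2 b) = mat24 1 0 0 b
                            1 0 0 0"
| "entry_msc E3 = mat24 0 0 0 1
                        1 0 0 0"
| "entry_msc E4 = mat24 1 0 0 1
                        0 0 0 0"
| "entry_msc E5 = mat24 1    0 0 (-1)
                        (-1) 0 0 1"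
| "entry_msc E6 = mat24 0 0 0 1
                        0 0 0 0"

text \<open>\<open>E1 b c\<close> and \<open>E1 c b\<close> count as one entry of the list.\<close>

definition same_entry :: "'f entry \<Rightarrow> 'f entry \<Rightarrow> bool" where
  "same_entry p q \<longleftrightarrow> p = q \<or> (\<exists>b c. p = E1 b c \<and> q = E1 c b)"

lemma mat24_nth [simp]:
  "mat24 a1 a2 a3 a4 b1 b2 b3 b4 $ 1 $ 1 = a1"
  "mat24 a1 a2 a3 a4 b1 b2 b3 b4 $ 1 $ 2 = a2"
  "mat24 a1 a2 a3 a4 b1 b2 b3 b4 $ 1 $ 3 = a3"
  "mat24 a1 a2 a3 a4 b1 b2 b3 b4 $ 1 $ 4 = a4"
  "mat24 a1 a2 a3 a4 b1 b2 b3 b4 $ 2 $ 1 = b1"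
  "mat24 a1 a2 a3 a4 b1 b2 b3 b4 $ 2 $ 2 = b2"
  "mat24 a1 a2 a3 a4 b1 b2 b3 b4 $ 2 $ 3 = b3"
  "mat24 a1 a2 a3 a4 b1 b2 b3 b4 $ 2 $ 4 = b4"
  by (simp_all add: mat24_def vector_def)

lemma kron_mat_kron_vec:
  fixes g h :: "'f::comm_semiring_1^2^2"
  shows "kron_mat g h *v kron_vec u v = kron_vec (g *v u) (h *v v)"
  by (simp add: kron_mat_def kron_vec_def vec_eq_iff forall_4 matrix_vector_mult_def sum_4 sum_2
      pair_fst_def pair_snd_def algebra_simps)

lemma msc_mult:
  fixes smul :: "'f::field \<Rightarrow> 'v::ab_group_add \<Rightarrow> 'v"
  assumes alg: "is_algebra smul mul" and e: "is_ordered_basis2 smul e"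
  defines "coords \<equiv> \<lambda>x. \<chi> k. module.representation smul (range e) x (e k)"
  shows "coords (mul x y) = msc smul mul e *v kron_vec (coords x) (coords y)"
proof -
  interpret V: vector_space smul using alg by (simp add: is_algebra_def)
  have B: "V.independent (range e)" "V.span (range e) = UNIV" and inj: "inj e"
    using e by (auto simp: is_ordered_basis2_def is_basis_def)
  let ?r = "V.representation (range e)"
  have re: "x = (\<Sum>k\<in>UNIV. smul (?r x (e k)) (e k))" for x
  proof -
    have "x = (\<Sum>b\<in>range e. smul (?r x b) b)"
      using V.sum_representation_eq[of "range e" x "range e"] B by simp
    also have "\<dots> = (\<Sum>k\<in>UNIV. smul (?r x (e k)) (e k))"
      by (simp add: sum.reindex[OF inj])
    finally show ?thesis .
  qed
  have l: "Vector_Spaces.linear smul smul (\<lambda>y. mul x y)"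
    and r: "Vector_Spaces.linear smul smul (\<lambda>x. mul x y)" for x y
    using alg by (auto simp: is_algebra_def)
  note lin = l[THEN Vector_Spaces.linear.axioms(3), THEN module_hom.add] l[THEN Vector_Spaces.linear.axioms(3), THEN module_hom.scale]
    r[THEN Vector_Spaces.linear.axioms(3), THEN module_hom.add] r[THEN Vector_Spaces.linear.axioms(3), THEN module_hom.scale]
  have "mul x y = mul (\<Sum>k\<in>UNIV. smul (?r x (e k)) (e k)) (\<Sum>k\<in>UNIV. smul (?r y (e k)) (e k))"
    using re[of x] re[of y] by simp
  also have "\<dots> = smul (?r x (e 1)) (smul (?r y (e 1)) (mul (e 1) (e 1))) +
       smul (?r x (e 1)) (smul (?r y (e 2)) (mul (e 1) (e 2))) +
       smul (?r x (e 2)) (smul (?r y (e 1)) (mul (e 2) (e 1))) +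
       smul (?r x (e 2)) (smul (?r y (e 2)) (mul (e 2) (e 2)))"
    by (simp add: sum_2 lin V.scale_right_distrib algebra_simps mult.commute)
  finally have m: "mul x y = \<dots>" .
  have a: "?r (u + v) b = ?r u b + ?r v b" and s: "?r (smul c u) b = c * ?r u b" for u v b c
    using V.representation_add[of "range e" v u] V.representation_scale[of "range e" u c] B by auto
  show ?thesis
    unfolding coords_def msc_def m
    by (simp add: vec_eq_iff matrix_vector_mult_def kron_vec_def sum_4 pair_fst_def pair_snd_def a s
        algebra_simps)
qed

text \<open>\<open>\<simeq>\<^sub>A\<close> is the usual isomorphism of the algebras on \<open>'f^2\<close> with product \<open>A (u \<otimes> v)\<close>.\<close>

lemma msc_iso_iff:
  fixes A B :: "'f::field^4^2"
  shows "A \<simeq>\<^sub>A B \<longleftrightarrow>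
    (\<exists>\<phi> :: 'f^2 \<Rightarrow> 'f^2. Vector_Spaces.linear (*s) (*s) \<phi> \<and> bij \<phi> \<and>
       (\<forall>u v. \<phi> (A *v kron_vec u v) = B *v kron_vec (\<phi> u) (\<phi> v)))"
    (is "_ \<longleftrightarrow> ?R")
proof
  assume "A \<simeq>\<^sub>A B"
  then obtain g :: "'f^2^2" where g: "invertible g"
    and B: "B = g ** A ** kron_mat (matrix_inv g) (matrix_inv g)"
    by (auto simp: msc_iso_def)
  have gi: "matrix_inv g ** g = mat 1" "g ** matrix_inv g = mat 1"
    using someI_ex[OF g[unfolded invertible_def]] by (simp_all add: matrix_inv_def)
  have gv: "matrix_inv g *v (g *v u) = u" "g *v (matrix_inv g *v u) = u" for u
    by (simp_all add: matrix_vector_mul_assoc gi)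
  have "bij ((*v) g)" by (rule bij_betw_byWitness[where f' = "(*v) (matrix_inv g)"]) (auto simp: gv)
  moreover have "g *v (A *v kron_vec u v) = B *v kron_vec (g *v u) (g *v v)" for u v
    by (simp add: B kron_mat_kron_vec gv flip: matrix_vector_mul_assoc)
  ultimately show ?R using matrix_vector_mul_linear_gen[of g] by blast
next
  assume ?R
  then obtain \<phi> :: "'f^2 \<Rightarrow> 'f^2" where lin: "Vector_Spaces.linear (*s) (*s) \<phi>" and bij: "bij \<phi>"
    and hom: "\<And>u v. \<phi> (A *v kron_vec u v) = B *v kron_vec (\<phi> u) (\<phi> v)" by blast
  define g where "g = matrix \<phi>"
  have g: "g *v u = \<phi> u" for u unfolding g_def by (rule matrix_works[OF lin])
  have inv: "invertible g"
    using bij by (simp add: bij_def invertible_left_inverse matrix_left_invertible_injective g inj_on_def)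
  have gv: "g *v (matrix_inv g *v u) = u" for u
    using someI_ex[OF inv[unfolded invertible_def]]
    by (simp add: matrix_vector_mul_assoc matrix_inv_def)
  define C where "C = g ** A ** kron_mat (matrix_inv g) (matrix_inv g)"
  have C: "C *v kron_vec u v = B *v kron_vec u v" for u v
    using hom[of "matrix_inv g *v u" "matrix_inv g *v v"]
    by (simp add: C_def kron_mat_kron_vec gv flip: matrix_vector_mul_assoc g)
  have "C $ k $ j = B $ k $ j" for k j
  proof -
    have "kron_vec (axis (pair_fst j) 1) (axis (pair_snd j) 1) = (axis j 1 :: 'f^4)"
      using exhaust_4[of j]
      by (auto simp: kron_vec_def vec_eq_iff forall_4 axis_def pair_fst_def pair_snd_def)
    then have "C *v axis j 1 = B *v axis j 1" by (metis C)
    moreover have "(M *v axis j 1) $ k = M $ k $ j" for M :: "'f^4^2"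
      using exhaust_4[of j] by (auto simp: matrix_vector_mult_def axis_def sum_4)
    ultimately show ?thesis by metis
  qed
  then have "C = B" by (simp add: vec_eq_iff)
  then show "A \<simeq>\<^sub>A B" using inv unfolding msc_iso_def C_def by blast
qed

end

theory Submission
  imports Defs
begin

text \<open>
  In a natural basis the structure constants are \<open>e1 e1 = (a, c)\<close>, \<open>e2 e2 = (b, d)\<close>.
  If these two vectors are independent, the natural basis is unique up to order and scaling, so
  normalizing by scaling gives \<open>E1\<close>, \<open>E2 b\<close> with \<open>b \<noteq> 0\<close>, and \<open>E3\<close>, and isomorphisms
  between these are diagonal or antidiagonal. If they are dependent, the product is
  \<open>u v = f(u, v) s\<close> for a diagonal bilinear form \<open>f\<close> and a fixed vector \<open>s\<close>, and the rank of
  \<open>f\<close> together with whether \<open>f(s, s) = 0\<close> separates \<open>E2 0\<close>, \<open>E4\<close>, \<open>E5\<close> and \<open>E6\<close>.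
\<close>

section \<open>Isomorphism of structure matrices: inverse-free form, symmetry, transitivity\<close>

lemma kron_mat_mult:
  fixes g h :: "'f::comm_semiring_1^2^2"
  shows "kron_mat g g ** kron_mat h h = kron_mat (g ** h) (g ** h)"
  by (simp add: kron_mat_def vec_eq_iff forall_4 matrix_matrix_mult_def sum_4 sum_2
      pair_fst_def pair_snd_def algebra_simps)

lemma kron_mat_one: "kron_mat (mat 1) (mat 1) = (mat 1 :: 'f::semiring_1^4^4)"
  by (simp add: kron_mat_def vec_eq_iff forall_4 mat_def pair_fst_def pair_snd_def)

text \<open>The inverse of \<open>kron_mat (matrix_inv g) (matrix_inv g)\<close> is
  \<open>kron_mat g g\<close>, so right multiplication clears the inverses. For explicit matrices
  the condition becomes polynomial in the entries of \<open>g\<close>.\<close>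

lemma msc_iso_iff_intertwine:
  fixes A B :: "'f::field^4^2"
  shows "A \<simeq>\<^sub>A B \<longleftrightarrow> (\<exists>g. invertible g \<and> g ** A = B ** kron_mat g g)"
proof -
  have "B = g ** A ** kron_mat (matrix_inv g) (matrix_inv g) \<longleftrightarrow> g ** A = B ** kron_mat g g"
    if g: "invertible g" for g :: "'f^2^2"
  proof -
    have gi: "matrix_inv g ** g = mat 1" "g ** matrix_inv g = mat 1"
      using someI_ex[OF g[unfolded invertible_def]] by (simp_all add: matrix_inv_def)
    have "kron_mat (matrix_inv g) (matrix_inv g) ** kron_mat g g = mat 1"
      "kron_mat g g ** kron_mat (matrix_inv g) (matrix_inv g) = mat 1"
      by (simp_all add: kron_mat_mult kron_mat_one gi)
    then have "M ** kron_mat (matrix_inv g) (matrix_inv g) ** kron_mat g g = M"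
      "M ** kron_mat g g ** kron_mat (matrix_inv g) (matrix_inv g) = M" for M :: "'f^4^2"
      by (simp_all flip: matrix_mul_assoc)
    then show ?thesis by metis
  qed
  then show ?thesis by (auto simp: msc_iso_def)
qed

lemma msc_iso_sym:
  assumes "A \<simeq>\<^sub>A B"
  shows "B \<simeq>\<^sub>A A"
proof -
  obtain g where g: "invertible g" "g ** A = B ** kron_mat g g"
    using assms by (auto simp: msc_iso_iff_intertwine)
  then obtain h where h: "g ** h = mat 1" "h ** g = mat 1"
    by (auto simp: invertible_def)
  then have "kron_mat g g ** kron_mat h h = mat 1"
    by (simp add: kron_mat_mult kron_mat_one)
  then have "h ** B = h ** (B ** kron_mat g g) ** kron_mat h h"
    by (simp flip: matrix_mul_assoc)
  also have "\<dots> = A ** kron_mat h h"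
    by (simp add: matrix_mul_assoc h flip: g(2))
  finally have "h ** B = A ** kron_mat h h" .
  moreover have "invertible h" using h by (auto simp: invertible_def)
  ultimately show ?thesis by (auto simp: msc_iso_iff_intertwine)
qed

lemma msc_iso_trans:
  assumes "A \<simeq>\<^sub>A B" "B \<simeq>\<^sub>A C"
  shows "A \<simeq>\<^sub>A C"
proof -
  obtain g h where g: "invertible g" "g ** A = B ** kron_mat g g"
    and h: "invertible h" "h ** B = C ** kron_mat h h"
    using assms by (auto simp: msc_iso_iff_intertwine)
  have "(h ** g) ** A = (h ** B) ** kron_mat g g"
    by (simp add: g flip: matrix_mul_assoc)
  also have "\<dots> = C ** kron_mat (h ** g) (h ** g)"
    by (simp add: h kron_mat_mult flip: matrix_mul_assoc)
  finally show ?thesis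
    using g h by (auto simp: msc_iso_iff_intertwine intro: invertible_mult)
qed

section \<open>Isomorphisms between algebras in natural bases\<close>

definition evolution_msc :: "'f::zero \<Rightarrow> 'f \<Rightarrow> 'f \<Rightarrow> 'f \<Rightarrow> 'f^4^2" where
  "evolution_msc a b c d = mat24 a 0 0 b c 0 0 d"

text \<open>The matrix with rows \<open>(x, y)\<close>, \<open>(z, w)\<close> is an isomorphism from \<open>(a, b, c, d)\<close> to
  \<open>(a', b', c', d')\<close>.\<close>

definition evolution_iso ::
    "'f::field \<Rightarrow> 'f \<Rightarrow> 'f \<Rightarrow> 'f \<Rightarrow> 'f \<Rightarrow> 'f \<Rightarrow> 'f \<Rightarrow> 'f \<Rightarrow> 'f \<Rightarrow> 'f \<Rightarrow> 'f \<Rightarrow> 'f \<Rightarrow> bool" where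
  "evolution_iso x y z w a b c d a' b' c' d' \<longleftrightarrow>
     x * w - y * z \<noteq> 0 \<and>
     x * a + y * c = a' * x\<^sup>2 + b' * z\<^sup>2 \<and> z * a + w * c = c' * x\<^sup>2 + d' * z\<^sup>2 \<and>
     a' * x * y + b' * z * w = 0 \<and> c' * x * y + d' * z * w = 0 \<and>
     x * b + y * d = a' * y\<^sup>2 + b' * w\<^sup>2 \<and> z * b + w * d = c' * y\<^sup>2 + d' * w\<^sup>2"

lemma evolution_msc_iso_iff:
  "evolution_msc a b c d \<simeq>\<^sub>A evolution_msc a' b' c' d' \<longleftrightarrow>
     (\<exists>x y z w. evolution_iso x y z w a b c d a' b' c' d')"
proof -
  have key: "invertible g \<and>
        g ** evolution_msc a b c d = evolution_msc a' b' c' d' ** kron_mat g g \<longleftrightarrow>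
      evolution_iso (g$1$1) (g$1$2) (g$2$1) (g$2$2) a b c d a' b' c' d'" for g
    by (auto simp: evolution_iso_def invertible_det_nz det_2 evolution_msc_def kron_mat_def
        vec_eq_iff forall_4 forall_2 matrix_matrix_mult_def sum_4 sum_2 pair_fst_def pair_snd_def
        power2_eq_square algebra_simps)
  have "\<exists>g :: 'a^2^2. evolution_iso (g$1$1) (g$1$2) (g$2$1) (g$2$2) a b c d a' b' c' d'"
    if "evolution_iso x y z w a b c d a' b' c' d'" for x y z w
    by (rule exI[of _ "vector [vector [x, y], vector [z, w]]"]) (simp add: that)
  then show ?thesis
    unfolding msc_iso_iff_intertwine key by blast
qed

lemma entry_msc_evolution:
  "entry_msc (E1 b c) = evolution_msc 1 b c 1"
  "entry_msc (E2 b) = evolution_msc 1 b 1 0"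
  "entry_msc E3 = evolution_msc 0 1 1 0"
  "entry_msc E4 = evolution_msc 1 1 0 0"
  "entry_msc E5 = evolution_msc 1 (-1) (-1) 1"
  "entry_msc E6 = evolution_msc 0 1 0 0"
  by (simp_all add: evolution_msc_def)

lemma evolution_msc_swap: "evolution_msc a b c d \<simeq>\<^sub>A evolution_msc d c b a"
  unfolding evolution_msc_iso_iff
  by (rule exI[of _ 0], rule exI[of _ 1], rule exI[of _ 1], rule exI[of _ 0])
    (simp add: evolution_iso_def)

section \<open>Existence of a normal form\<close>

definition listed :: "'f::field^4^2 \<Rightarrow> bool" where
  "listed A \<longleftrightarrow> (\<exists>p. in_list p \<and> A \<simeq>\<^sub>A entry_msc p)"

lemma listed_iso: "A \<simeq>\<^sub>A B \<Longrightarrow> listed B \<Longrightarrow> listed A"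
  unfolding listed_def by (meson msc_iso_trans)

lemma listedI:
  assumes "in_list p" "entry_msc p = evolution_msc a' b' c' d'"
    and "evolution_iso x y z w a b c d a' b' c' d'"
  shows "listed (evolution_msc a b c d)"
  unfolding listed_def using assms by (metis evolution_msc_iso_iff)

text \<open>Scaling the basis vectors, after an exchange if needed, suffices. The number of nonzero
  values among \<open>a\<close>, \<open>d\<close> selects the family: two for \<open>E1\<close>, one
  for \<open>E2\<close>, none for \<open>E3\<close>.\<close>

lemma listed_regular:
  fixes a b c d :: "'f::alg_closed_field"
  assumes D: "a * d - b * c \<noteq> 0"
  shows "listed (evolution_msc a b c d)"
proof -
  \<comment> \<open>For a diagonal isomorphism onto \<open>E2\<close>, \<open>x * a = x^2\<close>
    and \<open>w * c = x^2\<close> force \<open>x = a\<close> and \<open>w = a^2 / c\<close>; then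
    \<open>x * b = b' * w^2\<close> determines the parameter.\<close>
  have corner: "listed (evolution_msc a b c 0)" if "a \<noteq> 0" "b * c \<noteq> 0" for a b c :: 'f
    by (rule listedI[OF _ entry_msc_evolution(2)[of "a * b / (a\<^sup>2 / c)\<^sup>2"], of a 0 0 "a\<^sup>2 / c"])
      (use that in \<open>auto simp: evolution_iso_def power2_eq_square\<close>)
  consider "a \<noteq> 0" "d \<noteq> 0" | "a \<noteq> 0" "d = 0" | "a = 0" "d \<noteq> 0" | "a = 0" "d = 0" by blast
  then show ?thesis
  proof cases
    case 1
    \<comment> \<open>This is the product of the two parameters of \<open>E1\<close>; it differs
      from 1 by the hypothesis \<open>D\<close>.\<close>
    have "a * b / d\<^sup>2 * (d * c / a\<^sup>2) = b * c / (a * d)"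
      using 1 by (simp add: power2_eq_square)
    then have "in_list (E1 (a * b / d\<^sup>2) (d * c / a\<^sup>2))"
      using 1 D by (simp only: in_list.simps) simp
    then show ?thesis
      by (rule listedI[OF _ entry_msc_evolution(1), of _ _ a 0 0 d])
        (use 1 in \<open>simp add: evolution_iso_def power2_eq_square\<close>)
  next
    case 2
    then show ?thesis using corner D by auto
  next
    case 3
    then have "listed (evolution_msc d c b 0)" using corner D by (auto simp: mult.commute)
    then show ?thesis using 3 evolution_msc_swap listed_iso by metis
  next
    case 4
    then have bc: "b \<noteq> 0" "c \<noteq> 0" using D by auto
    \<comment> \<open>A diagonal isomorphism onto \<open>E3\<close> needs \<open>w * c = x^2\<close>
      and \<open>x * b = w^2\<close>; eliminating \<open>w\<close> leaves this cubic
      equation.\<close>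
    obtain x where x: "x ^ 3 = b * c\<^sup>2" using nth_root_exists[of 3] by fastforce
    then have x0: "x \<noteq> 0" using bc by auto
    have "(x\<^sup>2 / c)\<^sup>2 = x * (x ^ 3) / c\<^sup>2"
      by (simp add: power2_eq_square power3_eq_cube)
    then have "(x\<^sup>2 / c)\<^sup>2 = x * b" using x bc by simp
    then show ?thesis
      by (intro listedI[OF _ entry_msc_evolution(3), of x 0 0 "x\<^sup>2 / c"])
        (use 4 bc x0 in \<open>auto simp: evolution_iso_def\<close>)
  qed
qed

text \<open>Here \<open>f = diag(1, 0)\<close> and \<open>s = (a, c)\<close>, so
  \<open>f(s, s) = a^2\<close>: the result is \<open>E2 0\<close> if \<open>a\<close> is nonzero and
  \<open>E6\<close> otherwise.\<close>

lemma listed_one_square_zero: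
  fixes a c :: "'f::field"
  assumes "a \<noteq> 0 \<or> c \<noteq> 0"
  shows "listed (evolution_msc a 0 c 0)"
proof -
  consider "a \<noteq> 0" "c \<noteq> 0" | "a \<noteq> 0" "c = 0" | "a = 0" "c \<noteq> 0" using assms by blast
  then show ?thesis
  proof cases
    case 1
    then show ?thesis
      by (intro listedI[OF _ entry_msc_evolution(2)[of 0], of a 0 0 "a\<^sup>2 / c"])
        (auto simp: evolution_iso_def power2_eq_square)
  next
    case 2
    \<comment> \<open>The idempotent \<open>e1 / a\<close> is sent to \<open>e1 + e2\<close>, which
      is idempotent in \<open>E2 0\<close>; \<open>e2\<close> annihilates both algebras and is
      kept.\<close>
    then show ?thesis
      by (intro listedI[OF _ entry_msc_evolution(2)[of 0], of a 0 a 1])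
        (auto simp: evolution_iso_def power2_eq_square)
  next
    case 3
    then show ?thesis
      by (intro listedI[OF _ entry_msc_evolution(6), of 0 "1 / c" 1 0])
        (auto simp: evolution_iso_def)
  qed
qed

text \<open>Here \<open>u v = f(u, v) (a, c)\<close> for the bilinear form \<open>f = diag(1, k)\<close>; the two cases
  are whether the vector \<open>(a, c)\<close> is isotropic for \<open>f\<close>.\<close>

lemma listed_proportional_squares:
  fixes a c k :: "'f::alg_closed_field"
  assumes k: "k \<noteq> 0" and ac: "a \<noteq> 0 \<or> c \<noteq> 0"
  shows "listed (evolution_msc a (k * a) c (k * c))"
proof (cases "a\<^sup>2 + k * c\<^sup>2 = 0")
  case False
  obtain r where r: "r\<^sup>2 = k" using nth_root_exists[of 2] by fastforce
  have "r * (a\<^sup>2 + r\<^sup>2 * c\<^sup>2) \<noteq> 0" using False r k by auto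
  \<comment> \<open>The first row is \<open>u \<mapsto> f(s, u)\<close>, the second vanishes at
    \<open>s\<close>, so \<open>s\<close> goes to \<open>f(s, s) e1\<close>. With
    \<open>r^2 = k\<close> the squares of the two rows add up to \<open>f(s, s) f(u, u)\<close>,
    matching the form \<open>diag(1, 1)\<close> of \<open>E4\<close>.\<close>
  then show ?thesis
    by (intro listedI[OF _ entry_msc_evolution(4), of a "k * c" "- r * c" "r * a"])
      (auto simp: evolution_iso_def algebra_simps power2_eq_square simp flip: r)
next
  case True
  then have "a \<noteq> 0" "c \<noteq> 0" using k ac by auto
  moreover have "a\<^sup>2 = - (k * c\<^sup>2)" using True by (simp add: eq_neg_iff_add_eq_0)
  moreover from this have "a * (a * k) = - (k * c\<^sup>2) * k"
    by (simp add: power2_eq_square flip: mult.assoc)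
  \<comment> \<open>Since \<open>k * c^2 = - a^2\<close>, the map \<open>diag(a, k * c)\<close>
    sends \<open>s\<close> to \<open>a^2 (1, -1)\<close> and pulls the form
    \<open>diag(1, -1)\<close> of \<open>E5\<close> back to \<open>a^2 f\<close>.\<close>
  ultimately show ?thesis using k
    by (intro listedI[OF _ entry_msc_evolution(5), of a 0 0 "k * c"])
      (auto simp: evolution_iso_def algebra_simps power2_eq_square)
qed

lemma listed_evolution_msc:
  fixes a b c d :: "'f::alg_closed_field"
  assumes "\<not> (a = 0 \<and> b = 0 \<and> c = 0 \<and> d = 0)"
  shows "listed (evolution_msc a b c d)"
proof (cases "a * d - b * c = 0")
  case False
  then show ?thesis by (rule listed_regular)
next
  case D: True
  consider "a = 0" "c = 0" | "b = 0" "d = 0" | "a \<noteq> 0 \<or> c \<noteq> 0" "b \<noteq> 0 \<or> d \<noteq> 0" by blast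
  then show ?thesis
  proof cases
    case 1
    then have "listed (evolution_msc d 0 b 0)" using assms listed_one_square_zero by blast
    then show ?thesis using 1 evolution_msc_swap listed_iso by metis
  next
    case 2
    then show ?thesis using assms listed_one_square_zero by blast
  next
    case 3
    \<comment> \<open>The ratio of the two squares, read off a coordinate where the first one is
      nonzero.\<close>
    define k where "k = (if a = 0 then d / c else b / a)"
    have "b = k * a" "d = k * c" "k \<noteq> 0"
      using D 3 by (auto simp: k_def field_simps)
    then show ?thesis using listed_proportional_squares 3 by metis
  qed
qed

section \<open>Uniqueness of the normal form\<close>

lemma evolution_iso_det:
  assumes "evolution_iso x y z w a b c d a' b' c' d'"
  shows "(x * w - y * z) * (a * d - b * c) = (a' * d' - b' * c') * (x\<^sup>2 * w\<^sup>2 - y\<^sup>2 * z\<^sup>2)"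
proof -
  \<comment> \<open>Both sides of the claim are the minor on columns 1 and 4 in
    \<open>g ** A = B ** kron_mat g g\<close>.\<close>
  have "(x * w - y * z) * (a * d - b * c) =
      (x * a + y * c) * (z * b + w * d) - (x * b + y * d) * (z * a + w * c)"
    by (simp add: algebra_simps)
  also have "\<dots> = (a' * x\<^sup>2 + b' * z\<^sup>2) * (c' * y\<^sup>2 + d' * w\<^sup>2) -
      (a' * y\<^sup>2 + b' * w\<^sup>2) * (c' * x\<^sup>2 + d' * z\<^sup>2)"
    using assms by (simp add: evolution_iso_def)
  also have "\<dots> = (a' * d' - b' * c') * (x\<^sup>2 * w\<^sup>2 - y\<^sup>2 * z\<^sup>2)"
    by (simp add: algebra_simps)
  finally show ?thesis .
qed

text \<open>The determinant identity carries singularity only from target to source, because the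
  factor \<open>x * w + y * z\<close> of \<open>x^2 * w^2 - y^2 * z^2\<close> may vanish. The
  inverse isomorphism gives the other direction.\<close>

lemma evolution_msc_iso_regular:
  assumes "evolution_msc a b c d \<simeq>\<^sub>A evolution_msc a' b' c' d'"
  shows "a * d - b * c = 0 \<longleftrightarrow> a' * d' - b' * c' = 0"
proof -
  have imp: "a * d - b * c = 0"
    if "evolution_msc a b c d \<simeq>\<^sub>A evolution_msc a' b' c' d'" "a' * d' - b' * c' = 0"
    for a b c d a' b' c' d' :: 'a
  proof -
    obtain x y z w where h: "evolution_iso x y z w a b c d a' b' c' d'"
      using \<open>evolution_msc a b c d \<simeq>\<^sub>A _\<close> unfolding evolution_msc_iso_iff by blast
    then have "x * w - y * z \<noteq> 0" by (simp add: evolution_iso_def)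
    then show ?thesis using evolution_iso_det[OF h] that(2) by simp
  qed
  show ?thesis using imp[OF assms] imp[OF msc_iso_sym[OF assms]] by blast
qed

text \<open>The images of the two basis vectors have product zero. When the target squares are
  independent, Cramer's rule turns this into \<open>x * y = 0\<close> and
  \<open>z * w = 0\<close>.\<close>

lemma evolution_iso_regular:
  assumes h: "evolution_iso x y z w a b c d a' b' c' d'" and D: "a' * d' - b' * c' \<noteq> 0"
  shows "y = 0 \<and> z = 0 \<and> x \<noteq> 0 \<and> w \<noteq> 0 \<or> x = 0 \<and> w = 0 \<and> y \<noteq> 0 \<and> z \<noteq> 0"
proof -
  have e: "a' * x * y + b' * z * w = 0" "c' * x * y + d' * z * w = 0"
    using h by (auto simp: evolution_iso_def)
  have "(a' * d' - b' * c') * (x * y) =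
      d' * (a' * x * y + b' * z * w) - b' * (c' * x * y + d' * z * w)"
    "(a' * d' - b' * c') * (z * w) =
      a' * (c' * x * y + d' * z * w) - c' * (a' * x * y + b' * z * w)"
    by (simp_all add: algebra_simps)
  then have "x * y = 0" "z * w = 0" using D unfolding e by auto
  moreover have "x * w - y * z \<noteq> 0" using h by (simp add: evolution_iso_def)
  ultimately show ?thesis by auto
qed

lemma evolution_msc_iso_regularE:
  assumes "evolution_msc a b c d \<simeq>\<^sub>A evolution_msc a' b' c' d'" "a' * d' - b' * c' \<noteq> 0"
  obtains x w where "x \<noteq> 0" "w \<noteq> 0" "a = a' * x" "d = d' * w" "w * c = c' * x\<^sup>2" "x * b = b' * w\<^sup>2"
  | x w where "x \<noteq> 0" "w \<noteq> 0" "a = d' * x" "d = a' * w" "w * c = b' * x\<^sup>2" "x * b = c' * w\<^sup>2"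
proof -
  obtain x y z w where h: "evolution_iso x y z w a b c d a' b' c' d'"
    using assms(1) unfolding evolution_msc_iso_iff by blast
  from evolution_iso_regular[OF h assms(2)] show thesis
  proof (elim disjE conjE)
    assume "y = 0" "z = 0" "x \<noteq> 0" "w \<noteq> 0"
    then show thesis
      using h by (intro that(1)[of x w]) (auto simp: evolution_iso_def power2_eq_square)
  next
    assume "x = 0" "w = 0" "y \<noteq> 0" "z \<noteq> 0"
    then show thesis
      \<comment> \<open>The antidiagonal entries \<open>z\<close> and \<open>y\<close> take the
        roles of the two scalings.\<close>
      using h by (intro that(2)[of z y]) (auto simp: evolution_iso_def power2_eq_square)
  qed
qed

text \<open>One direction for each of the six pairs is enough, by \<open>msc_iso_sym\<close>. In
  each chosen direction the equations force the determinant \<open>x * w - y * z\<close> to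
  vanish.\<close>

lemma singular_entries_not_iso:
  fixes E :: "'f::field entry"
  defines "E \<equiv> E2 0"
  shows "\<not> entry_msc E4 \<simeq>\<^sub>A entry_msc E" "\<not> entry_msc E5 \<simeq>\<^sub>A entry_msc E"
    "\<not> entry_msc E6 \<simeq>\<^sub>A entry_msc E"
    "\<not> entry_msc (E4 :: 'f entry) \<simeq>\<^sub>A entry_msc E5"
    "\<not> entry_msc (E6 :: 'f entry) \<simeq>\<^sub>A entry_msc E4"
    "\<not> entry_msc (E6 :: 'f entry) \<simeq>\<^sub>A entry_msc E5"
proof -
  have False if h: "evolution_iso x y z w 1 1 0 0 1 0 1 0" for x y z w :: 'f
  proof -
    have "x * y = 0" "x = x\<^sup>2" "x = y\<^sup>2" "x * w - y * z \<noteq> 0"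
      using h by (auto simp: evolution_iso_def)
    then show False by auto
  qed
  then show "\<not> entry_msc E4 \<simeq>\<^sub>A entry_msc E"
    unfolding E_def entry_msc_evolution evolution_msc_iso_iff by blast
  have False if h: "evolution_iso x y z w 1 (-1) (-1) 1 1 0 1 0" for x y z w :: 'f
  proof -
    have "x * y = 0" "x - y = x\<^sup>2" "y - x = y\<^sup>2" "x * w - y * z \<noteq> 0"
      using h by (auto simp: evolution_iso_def)
    then show False by auto
  qed
  then show "\<not> entry_msc E5 \<simeq>\<^sub>A entry_msc E"
    unfolding E_def entry_msc_evolution evolution_msc_iso_iff by blast
  have False if h: "evolution_iso x y z w 0 1 0 0 1 0 1 0" for x y z w :: 'f
    using h by (auto simp: evolution_iso_def)
  then show "\<not> entry_msc E6 \<simeq>\<^sub>A entry_msc E"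
    unfolding E_def entry_msc_evolution evolution_msc_iso_iff by blast
  have False if h: "evolution_iso x y z w 1 1 0 0 1 (-1) (-1) 1" for x y z w :: 'f
  proof -
    have x: "x = x\<^sup>2 - z\<^sup>2" and z: "z = z\<^sup>2 - x\<^sup>2" and d: "x * w - y * z \<noteq> 0"
      using h by (auto simp: evolution_iso_def)
    \<comment> \<open>All products in \<open>E5\<close> are multiples of \<open>(1, -1)\<close>. Now
      \<open>x^2 = z^2\<close>, so \<open>x = 0\<close> and the first column is zero.\<close>
    have "z = - x" using x z by (metis minus_diff_eq)
    then show False using x d by simp
  qed
  then show "\<not> entry_msc (E4 :: 'f entry) \<simeq>\<^sub>A entry_msc E5"
    unfolding entry_msc_evolution evolution_msc_iso_iff by blast
  have False if h: "evolution_iso x y z w 0 1 0 0 1 1 0 0" for x y z w :: 'f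
    using h by (auto simp: evolution_iso_def)
  then show "\<not> entry_msc (E6 :: 'f entry) \<simeq>\<^sub>A entry_msc E4"
    unfolding entry_msc_evolution evolution_msc_iso_iff by blast
  have False if h: "evolution_iso x y z w 0 1 0 0 1 (-1) (-1) 1" for x y z w :: 'f
  proof -
    have x: "x = y\<^sup>2 - w\<^sup>2" and z: "z = w\<^sup>2 - y\<^sup>2" and xy: "x * y = z * w"
      and d: "x * w - y * z \<noteq> 0"
      using h by (auto simp: evolution_iso_def)
    have z': "z = - x" using x z by (metis minus_diff_eq)
    then have "x * (y + w) = 0" using xy by (simp add: algebra_simps)
    then show False using d unfolding z' by (auto simp: algebra_simps)
  qed
  then show "\<not> entry_msc (E6 :: 'f entry) \<simeq>\<^sub>A entry_msc E5"
    unfolding entry_msc_evolution evolution_msc_iso_iff by blast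
qed

text \<open>The value of \<open>a * d - b * c\<close> at each entry. Its vanishing, though not its
  value, is an isomorphism invariant.\<close>

fun entry_det :: "'f::field entry \<Rightarrow> 'f" where
  "entry_det (E1 b c) = 1 - b * c"
| "entry_det (E2 b) = - b"
| "entry_det E3 = - 1"
| "entry_det _ = 0"

lemma entry_det_eq_0_iff:
  assumes "entry_msc p \<simeq>\<^sub>A entry_msc q"
  shows "entry_det p = 0 \<longleftrightarrow> entry_det q = 0"
  using assms
  by (cases p; cases q) (simp_all only: entry_msc_evolution, (drule evolution_msc_iso_regular, simp)+)

lemma entry_msc_iso_same_entry:
  fixes p q :: "'f::field entry"
  assumes iso: "entry_msc p \<simeq>\<^sub>A entry_msc q" and l: "in_list p" "in_list q"
  shows "same_entry p q"
proof (cases "entry_det q = 0")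
  case False
  then show ?thesis
    using iso
    \<comment> \<open>Within \<open>E1\<close> and within \<open>E2\<close> the normalized
      coefficients force both scalings to be 1. An antidiagonal isomorphism between
      \<open>E1\<close> algebras exchanges the parameters, which is the exception in
      \<open>same_entry\<close>.\<close>
    by (cases p; cases q; simp only: entry_msc_evolution; elim evolution_msc_iso_regularE)
      (auto simp: same_entry_def power2_eq_square)
next
  case True
  then have "entry_det p = 0" using entry_det_eq_0_iff[OF iso] by simp
  then have "p \<in> {E2 0, E4, E5, E6}" using l by (cases p) auto
  moreover have "q \<in> {E2 0, E4, E5, E6}" using True l by (cases q) auto
  ultimately show ?thesis
    using iso msc_iso_sym[OF iso] singular_entries_not_iso
    by (auto simp: same_entry_def simp del: entry_msc.simps)
qed

lemma entry_msc_iso_iff: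
  assumes "in_list p" "in_list q"
  shows "entry_msc p \<simeq>\<^sub>A entry_msc q \<longleftrightarrow> same_entry p q"
proof
  assume "same_entry p q"
  moreover have "A \<simeq>\<^sub>A A" for A :: "'a^4^2"
    unfolding msc_iso_iff_intertwine by (rule exI[of _ "mat 1"]) (auto simp: kron_mat_one invertible_def intro: exI[of _ "mat 1"])
  ultimately show "entry_msc p \<simeq>\<^sub>A entry_msc q"
    unfolding same_entry_def by (metis entry_msc_evolution(1) evolution_msc_swap)
qed (use assms entry_msc_iso_same_entry in blast)

section \<open>From abstract algebras to structure matrices\<close>

lemma msc_change_basis:
  assumes alg: "is_algebra smul mul"
    and e: "is_ordered_basis2 smul e" and e': "is_ordered_basis2 smul e'"
  shows "msc smul mul e \<simeq>\<^sub>A msc smul mul e'"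
proof -
  interpret V: vector_space smul using alg by (simp add: is_algebra_def)
  \<comment> \<open>\<open>C f\<close> takes coordinates and \<open>S f\<close> recombines them; for
    an ordered basis they are mutually inverse, so \<open>C e' \<circ> S e\<close> is the change of
    coordinates.\<close>
  define C where "C f x = (\<chi> k. V.representation (range f) x (f k))" for f :: "2 \<Rightarrow> 'b" and x
  define S where "S f u = (\<Sum>k\<in>UNIV. smul (u $ k) (f k))" for f :: "2 \<Rightarrow> 'b" and u
  have basis: "V.independent (range f)" "V.span (range f) = UNIV" "inj f"
    if "is_ordered_basis2 smul f" for f :: "2 \<Rightarrow> 'b"
    using that by (auto simp: is_ordered_basis2_def is_basis_def)
  have SC: "S f (C f x) = x" if f: "is_ordered_basis2 smul f" for f x
    using V.sum_representation_eq[of "range f" x "range f"] basis[OF f]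
    by (simp add: C_def S_def sum.reindex)
  have C_add: "C f (x + y) = C f x + C f y" and C_scale: "C f (smul r x) = r *s C f x"
    if f: "is_ordered_basis2 smul f" for f x y r
    using V.representation_add[of "range f" y x] V.representation_scale[of "range f" x r]
      basis[OF f] by (auto simp: C_def vec_eq_iff)
  have CS: "C f (S f u) = u" if f: "is_ordered_basis2 smul f" for f u
  proof -
    have "V.representation (range f) (f j) (f k) = (if k = j then 1 else 0)" for j k
      using V.representation_basis[of "range f" "f j"] basis[OF f] by (auto simp: inj_eq)
    then have "C f (f j) = axis j 1" for j by (auto simp: C_def axis_def vec_eq_iff)
    then show ?thesis
      by (simp add: S_def sum_2 C_add[OF f] C_scale[OF f] vec_eq_iff forall_2 axis_def)
  qed
  have S_add: "S f (u + v) = S f u + S f v" and S_scale: "S f (r *s u) = smul r (S f u)" for f u v r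
    by (simp_all add: S_def sum_2 V.scale_left_distrib V.scale_right_distrib algebra_simps)
  let ?\<phi> = "\<lambda>u. C e' (S e u)"
  have "Vector_Spaces.linear (*s) (*s) ?\<phi>"
    unfolding Vector_Spaces.linear_iff
    by (auto simp: S_add S_scale C_add[OF e'] C_scale[OF e'] vec.vector_space_axioms)
  moreover have "bij ?\<phi>"
    by (rule bij_betw_byWitness[where f' = "\<lambda>u. C e (S e' u)"])
      (auto simp: SC[OF e] SC[OF e'] CS[OF e] CS[OF e'])
  moreover have "?\<phi> (msc smul mul e *v kron_vec u v) = msc smul mul e' *v kron_vec (?\<phi> u) (?\<phi> v)"
    for u v
  proof -
    have "msc smul mul e *v kron_vec u v = C e (mul (S e u) (S e v))"
      using msc_mult[OF alg e, of "S e u" "S e v"] CS[OF e] by (simp flip: C_def)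
    then have "?\<phi> (msc smul mul e *v kron_vec u v) = C e' (mul (S e u) (S e v))"
      by (simp add: SC[OF e])
    also have "\<dots> = msc smul mul e' *v kron_vec (?\<phi> u) (?\<phi> v)"
      using msc_mult[OF alg e', of "S e u" "S e v"] by (simp flip: C_def)
    finally show ?thesis .
  qed
  ultimately show ?thesis unfolding msc_iso_iff by blast
qed

lemma evolution_algebra_natural_basis:
  assumes "is_evolution_algebra 2 smul mul"
  obtains e a b c d where "is_ordered_basis2 smul e" "msc smul mul e = evolution_msc a b c d"
proof -
  obtain B where B: "is_basis smul B" "card B = 2"
    and orth: "\<And>x y. x \<in> B \<Longrightarrow> y \<in> B \<Longrightarrow> x \<noteq> y \<Longrightarrow> mul x y = 0"
    using assms by (auto simp: is_evolution_algebra_def)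
  interpret V: vector_space smul
    using assms by (simp add: is_evolution_algebra_def is_algebra_def)
  obtain u v where uv: "B = {u, v}" "u \<noteq> v" using B(2) by (auto simp: card_2_iff)
  define e :: "2 \<Rightarrow> 'b" where "e k = (if k = 1 then u else v)" for k
  have "range e = B" by (auto simp: e_def uv image_def intro: exI[of _ 1] exI[of _ 2])
  moreover have "inj e" using uv(2) exhaust_2 by (auto simp: inj_def e_def)
  ultimately have "is_ordered_basis2 smul e" using B by (simp add: is_ordered_basis2_def)
  moreover have "msc smul mul e = evolution_msc (msc smul mul e $ 1 $ 1) (msc smul mul e $ 1 $ 4)
      (msc smul mul e $ 2 $ 1) (msc smul mul e $ 2 $ 4)"
    using orth[of u v] orth[of v u] uv
    by (simp add: evolution_msc_def vec_eq_iff forall_2 forall_4 msc_def pair_fst_def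
        pair_snd_def e_def V.representation_zero)
  ultimately show thesis by (rule that)
qed

lemma msc_nonzero:
  assumes alg: "is_algebra smul mul" and e: "is_ordered_basis2 smul e" and nt: "nontrivial_mult mul"
  shows "msc smul mul e \<noteq> 0"
proof
  assume 0: "msc smul mul e = 0"
  interpret V: vector_space smul using alg by (simp add: is_algebra_def)
  have "mul x y = 0" for x y
  proof -
    have "V.representation (range e) (mul x y) (e k) = 0" for k
      using msc_mult[OF alg e, of x y] by (simp add: 0 vec_eq_iff)
    then show ?thesis
      using V.sum_representation_eq[of "range e" "mul x y" "range e"] e
      by (simp add: is_ordered_basis2_def is_basis_def sum.reindex)
  qed
  then show False using nt by (simp add: nontrivial_mult_def)
qed

theorem theorem2p3:
  fixes smul :: "'f::alg_closed_field \<Rightarrow> 'v::ab_group_add \<Rightarrow> 'v"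
    and mul :: "'v \<Rightarrow> 'v \<Rightarrow> 'v"
  shows "(is_evolution_algebra 2 smul mul \<and> nontrivial_mult mul \<longrightarrow>
            (\<forall>e. is_ordered_basis2 smul e \<longrightarrow>
              (\<exists>p. in_list p \<and> msc smul mul e \<simeq>\<^sub>A entry_msc p \<and>
                 (\<forall>q. in_list q \<and> msc smul mul e \<simeq>\<^sub>A entry_msc q \<longrightarrow> same_entry p q)))) \<and>
         (\<forall>p q :: 'f entry. in_list p \<and> in_list q \<longrightarrow>
            (entry_msc p \<simeq>\<^sub>A entry_msc q \<longleftrightarrow> same_entry p q))"
proof (intro conjI impI allI; (elim conjE)?)
  fix e :: "2 \<Rightarrow> 'v"
  assume ev: "is_evolution_algebra 2 smul mul" and nt: "nontrivial_mult mul"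
    and e: "is_ordered_basis2 smul e"
  have alg: "is_algebra smul mul" using ev by (simp add: is_evolution_algebra_def)
  obtain e' a b c d where e': "is_ordered_basis2 smul e'"
    and m: "msc smul mul e' = evolution_msc a b c d"
    using evolution_algebra_natural_basis[OF ev] by metis
  have "\<not> (a = 0 \<and> b = 0 \<and> c = 0 \<and> d = 0)"
    using msc_nonzero[OF alg e' nt] m
    by (auto simp: evolution_msc_def vec_eq_iff forall_2 forall_4)
  \<comment> \<open>The given basis \<open>e\<close> need not be natural; the normal form is found
    in \<open>e'\<close> and transported by the change of basis.\<close>
  then have "listed (msc smul mul e)"
    using listed_evolution_msc listed_iso msc_change_basis[OF alg e e'] m by metis
  then show "\<exists>p. in_list p \<and> msc smul mul e \<simeq>\<^sub>A entry_msc p \<and>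
      (\<forall>q. in_list q \<and> msc smul mul e \<simeq>\<^sub>A entry_msc q \<longrightarrow> same_entry p q)"
    unfolding listed_def by (meson entry_msc_iso_iff msc_iso_sym msc_iso_trans)
next
  fix p q :: "'f entry"
  assume "in_list p" "in_list q"
  then show "entry_msc p \<simeq>\<^sub>A entry_msc q \<longleftrightarrow> same_entry p q" by (rule entry_msc_iso_iff)
qed

end
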